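(* Let $0<\varepsilon<1/2$. There is an integer $s<100/\varepsilon$ such that for $\pi(N)(1+o(1))$ primes $p\le N$ (as $N\to\infty$), every integer $\lambda$ can be written as $$F_{n_1}+\cdots+F_{n_s}\equiv\lambda\pmod p,$$ where $1\le n_i\le N^{\varepsilon}$ for $i=1,\ldots,s$.
   Context: $\{F_n\}$ is the Fibonacci sequence: $F_1=F_2=1$, $F_{n+2}=F_{n+1}+F_n$ for $n\ge1$. $\pi(N)$ denotes the number of primes $p\le N$. *)

theory Defs
  imports Complex_Main "HOL-Number_Theory.Fib" "HOL-Number_Theory.Cong" "HOL-Computational_Algebra.Primes"
    "HOL-Library.Landau_Symbols"
begin

text \<open>fib from HOL-Number_Theory.Fib: fib 0 = 0, fib 1 = 1, fib 2 = 1, so fib n = F_n for n >= 1.\<close>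

definition fib_sums_cover :: "nat \<Rightarrow> real \<Rightarrow> nat \<Rightarrow> nat \<Rightarrow> bool" where
  "fib_sums_cover s \<epsilon> N p \<longleftrightarrow>
     (\<forall>l::int. \<exists>n :: nat \<Rightarrow> nat.
        (\<forall>i<s. 1 \<le> n i \<and> real (n i) \<le> real N powr \<epsilon>) \<and>
        [(\<Sum>i<s. int (fib (n i))) = l] (mod int p))"

end

theory Submission
  imports Defs "HOL-Analysis.Convex" "HOL-Real_Asymp.Real_Asymp"
begin

text \<open>
  Write \<open>L\<^sub>n\<close> for the Lucas numbers. For odd \<open>m \<le> n\<close> one has
  \<open>F\<^sub>m L\<^sub>n = F\<^sub>n\<^sub>+\<^sub>m + F\<^sub>n\<^sub>-\<^sub>m\<close>, so if \<open>A\<close> is the set of sums of \<open>k\<close> distinct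
  \<open>F\<^sub>m\<close> with odd \<open>m < 2M\<close>, and \<open>B\<close> is the set of \<open>L\<^sub>n\<close> with \<open>2M \<le> n < 2M + J\<close>, every sum of eight
  products from \<open>A \<cdot> B\<close> is a sum of \<open>16k\<close> Fibonacci numbers.

  Eight products represent every residue (an argument of Glibichuk) as soon as
  \<open>|A| |B| > 2p\<close> modulo \<open>p\<close> and no two elements of \<open>B\<close> add up to \<open>0\<close>. On average over \<open>\<xi>\<close> there are few
  coincidences \<open>a - a' = \<xi> (b - b')\<close>, so for some \<open>\<xi>\<close> both \<open>A + \<xi> B\<close> and \<open>A - \<xi> B\<close> have more than
  \<open>p/2\<close> elements. The latter then meets its own negative, which gives
  \<open>\<xi> = (a\<^sub>1 + a\<^sub>2) / (b\<^sub>1 + b\<^sub>2)\<close>; the former satisfies \<open>(A + \<xi> B) + (A + \<xi> B) = \<int>/p\<close>,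
  and multiplying by \<open>b\<^sub>1 + b\<^sub>2\<close> clears the denominator.

  The sums in \<open>A\<close> are distinct integers below \<open>4\<^sup>M\<close>, so a difference of two of them has at most
  \<open>2M\<close> prime factors, and for most primes \<open>p \<le> N\<close> there are few collisions modulo \<open>p\<close>; likewise
  \<open>L\<^sub>n \<plusminus> L\<^sub>m\<close> is divisible by few primes. With \<open>\<delta> = \<epsilon>/4\<close>, \<open>M\<close> about \<open>N\<close> to the power \<open>\<delta>\<close>, \<open>J\<close> about
  \<open>M\<^sup>2\<close> and \<open>k\<close> slightly above \<open>1/\<delta>\<close>, all but a power-saving number of primes are good, which is
  negligible against Chebyshev's lower bound for \<open>\<pi>(N)\<close>.
\<close>

subsection \<open>Collisions and prime divisors\<close>

text \<open>Cauchy-Schwarz on the fibre sizes of \<open>f\<close>: they add up to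
  \<open>card S\<close>, and their squares add up to the number of colliding pairs.\<close>

lemma card_squared_le_card_image_collisions:
  assumes "finite S"
  shows "(card S)\<^sup>2 \<le> card (f ` S) * card {(x, y) \<in> S \<times> S. f x = f y}"
proof -
  define c where "c z = card {x \<in> S. f x = z}" for z
  have "{(x, y) \<in> S \<times> S. f x = f y}
      = (\<Union>z\<in>f ` S. {x \<in> S. f x = z} \<times> {x \<in> S. f x = z})"
    by auto
  then have "card {(x, y) \<in> S \<times> S. f x = f y}
      = (\<Sum>z\<in>f ` S. card ({x \<in> S. f x = z} \<times> {x \<in> S. f x = z}))"
    using assms by (simp only:) (rule card_UN_disjoint; auto)
  then have coll: "card {(x, y) \<in> S \<times> S. f x = f y} = (\<Sum>z\<in>f ` S. (c z)\<^sup>2)"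
    by (simp add: c_def card_cartesian_product power2_eq_square)
  have "S = (\<Union>z\<in>f ` S. {x \<in> S. f x = z})"
    by auto
  then have "card S = card (\<Union>z\<in>f ` S. {x \<in> S. f x = z})"
    by simp
  also have "\<dots> = (\<Sum>z\<in>f ` S. c z)"
    unfolding c_def using assms by (intro card_UN_disjoint) auto
  finally have size: "card S = (\<Sum>z\<in>f ` S. c z)" .
  have "(\<Sum>z\<in>f ` S. real (c z))\<^sup>2 \<le> (\<Sum>z\<in>f ` S. (real (c z))\<^sup>2) * card (f ` S)"
    by (rule sum_squared_le_sum_of_squares)
  also have "(\<Sum>z\<in>f ` S. real (c z))\<^sup>2 = real ((card S)\<^sup>2)"
    by (simp add: size)
  also have "(\<Sum>z\<in>f ` S. (real (c z))\<^sup>2) * card (f ` S)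
      = real (card (f ` S) * card {(x, y) \<in> S \<times> S. f x = f y})"
    unfolding coll by simp
  finally show ?thesis
    by (simp only: of_nat_le_iff)
qed

text \<open>Distinct primes are coprime, so their product, which is at least
  \<open>2 ^ card P\<close>, divides the nonzero \<open>d\<close>.\<close>

lemma card_prime_divisors_le:
  fixes d :: int
  assumes "finite P" and "\<And>p. p \<in> P \<Longrightarrow> prime p \<and> int p dvd d"
    and "d \<noteq> 0" and "\<bar>d\<bar> \<le> 2 ^ H"
  shows "card P \<le> H"
proof -
  have "\<Prod>P dvd nat \<bar>d\<bar>"
    using assms(1,2)
  proof (induction P rule: finite_induct)
    case (insert p P)
    have "coprime p (\<Prod>P)"
      using insert by (intro prod_coprime_right) (metis insertCI primes_coprime)
    moreover have "p dvd nat \<bar>d\<bar>"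
      using insert.prems by (simp add: int_dvd_int_iff [symmetric])
    moreover have "\<Prod>P dvd nat \<bar>d\<bar>"
      using insert by blast
    ultimately show ?case
      using insert by (simp add: divides_mult del: dvd_nat_abs_iff nat_abs_dvd_iff)
  qed simp
  then have "\<Prod>P \<le> nat \<bar>d\<bar>"
    using \<open>d \<noteq> 0\<close> by (intro dvd_imp_le) auto
  moreover have "2 ^ card P \<le> \<Prod>P"
  proof -
    have "(\<Prod>p\<in>P. 2) \<le> (\<Prod>p\<in>P. p)"
      using assms(2) by (intro prod_mono) (auto simp: prime_ge_2_nat)
    then show ?thesis by simp
  qed
  moreover have "nat \<bar>d\<bar> \<le> 2 ^ H"
    using \<open>\<bar>d\<bar> \<le> 2 ^ H\<close> by (simp add: nat_le_iff)
  ultimately have "(2::nat) ^ card P \<le> 2 ^ H"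
    by linarith
  then show ?thesis
    by simp
qed

text \<open>Double counting: with the order of summation exchanged, every \<open>x\<close>
  contributes at most \<open>H\<close> primes.\<close>

lemma sum_card_prime_divisors_le:
  fixes g :: "'a \<Rightarrow> int"
  assumes "finite P" and "\<And>p. p \<in> P \<Longrightarrow> prime p" and "finite D"
    and "\<And>x. x \<in> D \<Longrightarrow> g x \<noteq> 0" and "\<And>x. x \<in> D \<Longrightarrow> \<bar>g x\<bar> \<le> 2 ^ H"
  shows "(\<Sum>p\<in>P. card {x \<in> D. int p dvd g x}) \<le> card D * H"
proof -
  have "(\<Sum>p\<in>P. card {x \<in> D. int p dvd g x}) = (\<Sum>x\<in>D. card {p \<in> P. int p dvd g x})"
    using assms(1,3) by (intro sum_multicount_gen) auto
  also have "\<dots> \<le> (\<Sum>x\<in>D. H)"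
    using assms by (intro sum_mono card_prime_divisors_le) auto
  finally show ?thesis
    by simp
qed

text \<open>Markov's inequality; it turns a bound on the total number of collisions into a bound on
  the number of bad primes.\<close>

lemma card_ge_threshold_le:
  fixes c :: "'a \<Rightarrow> nat" and C :: real
  assumes "finite P" and "C > 0" and "(\<Sum>p\<in>P. c p) \<le> K"
  shows "real (card {p \<in> P. real (c p) \<ge> C}) \<le> real K / C"
proof -
  have "real (card {p \<in> P. real (c p) \<ge> C}) * C = (\<Sum>p\<in>{p \<in> P. real (c p) \<ge> C}. C)"
    by simp
  also have "\<dots> \<le> (\<Sum>p\<in>{p \<in> P. real (c p) \<ge> C}. real (c p))"
    by (rule sum_mono) auto
  also have "\<dots> \<le> (\<Sum>p\<in>P. real (c p))"
    using assms(1) by (intro sum_mono2) auto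
  also have "\<dots> \<le> real K"
    using assms(3) by (metis of_nat_le_iff of_nat_sum)
  finally show ?thesis
    using \<open>C > 0\<close> by (simp add: field_simps)
qed

subsection \<open>Sums of eight products\<close>

lemma cong_residues_imp_eq:
  fixes x y p :: int
  assumes "[x = y] (mod p)" and "x \<in> S" and "y \<in> S" and "S \<subseteq> {0..<p}"
  shows "x = y"
  using assms cong_less_imp_eq_int[of x p y] by (metis atLeastLessThan_iff subsetD)

text \<open>Pigeonhole: among \<open>p\<close> residues there is no room for \<open>X\<close> and
  the reflected set \<open>c - Y\<close> to be disjoint.\<close>

lemma residue_sumset_cover:
  fixes X Y :: "int set" and p :: int
  assumes p: "p > 0" and "X \<subseteq> {0..<p}" and "Y \<subseteq> {0..<p}" and "int (card X) + int (card Y) > p"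
  obtains x y where "x \<in> X" and "y \<in> Y" and "[x + y = c] (mod p)"
proof -
  have inj: "inj_on (\<lambda>y. (c - y) mod p) Y"
  proof (rule inj_onI)
    fix y z assume yz: "y \<in> Y" "z \<in> Y" "(c - y) mod p = (c - z) mod p"
    then have "p dvd (c - y) - (c - z)" by (simp only: mod_eq_dvd_iff)
    then have "[z = y] (mod p)" by (simp add: cong_iff_dvd_diff)
    then show "y = z"
      using yz(2,1) assms(3) by (rule cong_residues_imp_eq[symmetric])
  qed
  have "X \<inter> (\<lambda>y. (c - y) mod p) ` Y \<noteq> {}"
  proof
    assume disj: "X \<inter> (\<lambda>y. (c - y) mod p) ` Y = {}"
    have fin: "finite X" "finite Y"
      using assms finite_subset by blast+
    have "card X + card Y = card (X \<union> (\<lambda>y. (c - y) mod p) ` Y)"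
      using disj fin inj by (simp add: card_Un_disjoint card_image)
    also have "\<dots> \<le> card {0..<p}"
      using assms(2) p by (intro card_mono) auto
    finally show False
      using assms(4) p by (simp add: nat_le_iff le_nat_iff)
  qed
  then obtain x y where xy: "x \<in> X" "y \<in> Y" "x = (c - y) mod p"
    by blast
  then have "[x + y = c - y + y] (mod p)"
    by (intro cong_add) (auto simp: unique_euclidean_semiring_class.cong_def)
  with xy that show thesis by simp
qed

text \<open>Averaging over the \<open>p - 1\<close> dilates: a diagonal quadruple
  (\<open>a = a'\<close>, \<open>b = b'\<close>) is counted for every \<xi>, any other one for at
  most one \<xi>. A minimiser does no worse than the mean.\<close>

lemma exists_dilate_few_coincidences:
  fixes A B :: "int set" and p :: nat
  assumes "prime p" and "A \<subseteq> {0..<int p}" and "B \<subseteq> {0..<int p}"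
  obtains \<xi> where "\<xi> \<in> {1..<int p}"
    and "(int p - 1) * int (card {(a, a', b, b'). a \<in> A \<and> a' \<in> A \<and> b \<in> B \<and> b' \<in> B \<and>
             [a - a' = \<xi> * (b - b')] (mod int p)})
         \<le> (int p - 1) * int (card A * card B) + int ((card A * card B)\<^sup>2)"
proof -
  define Q where "Q = A \<times> A \<times> B \<times> B"
  define D where "D = (\<lambda>(a, b). (a, a, b, b)) ` (A \<times> B)"
  define R where "R \<xi> = (\<lambda>(a, a', b, b'). [a - a' = \<xi> * (b - b')] (mod int p))" for \<xi>
  define E where "E \<xi> = {q \<in> Q. R \<xi> q}" for \<xi>
  have p: "int p > 1" using assms(1) prime_gt_1_nat by auto
  have fin: "finite A" "finite B" "finite Q" "finite D"
    using assms finite_subset[of _ "{0..<int p}"] by (auto simp: Q_def D_def)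
  have "D \<subseteq> Q" by (auto simp: D_def Q_def)
  have cardD: "card D = card A * card B"
    unfolding D_def by (subst card_image) (auto intro!: inj_onI simp: card_cartesian_product)
  have cardQ: "card Q = (card A * card B)\<^sup>2"
    unfolding Q_def by (simp add: card_cartesian_product power2_eq_square)
  have card_p: "card {1..<int p} = p - 1"
    by (simp add: nat_diff_distrib)
  \<comment> \<open>If \<open>b = b'\<close>, the relation forces \<open>a = a'\<close>, which is
    impossible off the diagonal; otherwise \<open>b - b'\<close> is invertible and determines
    \<xi>.\<close>
  have unique: "card {\<xi> \<in> {1..<int p}. R \<xi> q} \<le> 1" if q: "q \<in> Q - D" for q
  proof -
    obtain a a' b b' where [simp]: "q = (a, a', b, b')"
      and mem: "a \<in> A" "a' \<in> A" "b \<in> B" "b' \<in> B"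
      using q by (auto simp: Q_def)
    have "\<xi> = \<eta>" if h: "\<xi> \<in> {1..<int p}" "R \<xi> q" "\<eta> \<in> {1..<int p}" "R \<eta> q" for \<xi> \<eta>
    proof (cases "b = b'")
      case True
      then have "[a - a' = 0] (mod int p)" using h by (simp add: R_def)
      then have "[a = a'] (mod int p)" by (simp add: cong_iff_dvd_diff)
      then have "a = a'" using mem(1,2) assms(2) by (rule cong_residues_imp_eq)
      with True mem q show ?thesis by (auto simp: D_def)
    next
      case False
      have "[\<xi> * (b - b') = \<eta> * (b - b')] (mod int p)"
        using h by (auto simp: R_def intro: cong_trans cong_sym)
      then have "int p dvd (\<xi> - \<eta>) * (b - b')"
        by (simp add: cong_iff_dvd_diff algebra_simps)
      moreover have "\<not> int p dvd b - b'"
      proof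
        assume "int p dvd b - b'"
        then have "[b = b'] (mod int p)" by (simp add: cong_iff_dvd_diff)
        then show False using cong_residues_imp_eq[OF _ mem(3,4) assms(3)] False by simp
      qed
      ultimately have "int p dvd \<xi> - \<eta>"
        using assms(1) by (simp add: prime_dvd_mult_iff)
      then have "[\<xi> = \<eta>] (mod int p)" by (simp add: cong_iff_dvd_diff)
      then show ?thesis using h(1,3) by (rule cong_residues_imp_eq) auto
    qed
    then have "\<forall>\<xi>\<in>{\<xi> \<in> {1..<int p}. R \<xi> q}. \<forall>\<eta>\<in>{\<xi> \<in> {1..<int p}. R \<xi> q}. \<xi> = \<eta>"
      by blast
    moreover have "finite {\<xi> \<in> {1..<int p}. R \<xi> q}"
      by (rule finite_subset[of _ "{1..<int p}"]) auto
    ultimately show ?thesis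
      unfolding One_nat_def by (simp only: card_le_Suc0_iff_eq)
  qed
  have "(\<Sum>\<xi>\<in>{1..<int p}. card (E \<xi>)) = (\<Sum>q\<in>Q. card {\<xi> \<in> {1..<int p}. R \<xi> q})"
    unfolding E_def using fin by (intro sum_multicount_gen) auto
  also have "\<dots> = (\<Sum>q\<in>D. card {\<xi> \<in> {1..<int p}. R \<xi> q})
      + (\<Sum>q\<in>Q - D. card {\<xi> \<in> {1..<int p}. R \<xi> q})"
    using fin \<open>D \<subseteq> Q\<close> by (subst sum.subset_diff[of D Q]) auto
  also have "\<dots> \<le> (\<Sum>q\<in>D. card {1..<int p}) + (\<Sum>q\<in>Q - D. 1)"
    using unique by (intro add_mono sum_mono card_mono) auto
  also have "\<dots> \<le> card D * (p - 1) + card Q"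
    using card_mono[of Q "Q - D"] fin card_p by auto
  finally have total: "(\<Sum>\<xi>\<in>{1..<int p}. card (E \<xi>)) \<le> card D * (p - 1) + card Q" .
  have ne: "{1..<int p} \<noteq> {}" using p by auto
  define \<xi> where "\<xi> = arg_min_on (\<lambda>\<xi>. card (E \<xi>)) {1..<int p}"
  have \<xi>: "\<xi> \<in> {1..<int p}" "\<And>\<eta>. \<eta> \<in> {1..<int p} \<Longrightarrow> card (E \<xi>) \<le> card (E \<eta>)"
    using arg_min_if_finite(1)[of "{1..<int p}" "\<lambda>\<xi>. card (E \<xi>)"]
      arg_min_least[of "{1..<int p}" _ "\<lambda>\<xi>. card (E \<xi>)"] ne by (auto simp: \<xi>_def)
  have "(p - 1) * card (E \<xi>) = (\<Sum>\<eta>\<in>{1..<int p}. card (E \<xi>))"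
    using card_p by simp
  also have "\<dots> \<le> (\<Sum>\<eta>\<in>{1..<int p}. card (E \<eta>))"
    using \<xi> by (intro sum_mono) auto
  finally have "(p - 1) * card (E \<xi>) \<le> (p - 1) * (card A * card B) + (card A * card B)\<^sup>2"
    using total by (simp add: cardD cardQ mult.commute)
  then have "int ((p - 1) * card (E \<xi>)) \<le> int ((p - 1) * (card A * card B) + (card A * card B)\<^sup>2)"
    by (simp only: of_nat_le_iff)
  moreover have "int (p - 1) = int p - 1" using p by simp
  moreover have "E \<xi> = {(a, a', b, b'). a \<in> A \<and> a' \<in> A \<and> b \<in> B \<and> b' \<in> B \<and>
             [a - a' = \<xi> * (b - b')] (mod int p)}"
    by (auto simp: E_def Q_def R_def)
  ultimately show thesis
    using that[OF \<xi>(1)] by simp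
qed

lemma eight_products_cover:
  fixes A B :: "int set" and p :: nat
  assumes "prime p" and A: "A \<subseteq> {0..<int p}" and B: "B \<subseteq> {0..<int p}"
    and large: "card A * card B > 2 * p"
    and antisym: "\<And>b b'. b \<in> B \<Longrightarrow> b' \<in> B \<Longrightarrow> \<not> int p dvd b + b'"
  obtains a1 a2 a3 a4 b1 b2 b3 b4
    where "{a1, a2, a3, a4} \<subseteq> A" and "{b1, b2, b3, b4} \<subseteq> B"
      and "[(a1 + a2) * (b3 + b4) + (a3 + a4) * (b1 + b2) = l] (mod int p)"
proof -
  define K where "K = int (card A * card B)"
  have fin: "finite A" "finite B"
    using A B finite_subset by blast+
  have K: "K > 2 * int p" using large unfolding K_def by linarith
  have "B \<noteq> {}" using large by auto
  \<comment> \<open>The sum \<open>b + b\<close> is even, so \<open>antisym\<close> excludes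
    \<open>p = 2\<close>.\<close>
  have p: "p \<ge> 3"
  proof -
    obtain b where "b \<in> B" using \<open>B \<noteq> {}\<close> by auto
    then have "\<not> int p dvd b + b" using antisym by blast
    then have "p \<noteq> 2" by auto
    then show ?thesis using prime_ge_2_nat[OF assms(1)] by linarith
  qed
  obtain \<xi> where \<xi>: "\<xi> \<in> {1..<int p}"
    and few: "(int p - 1) * int (card {(a, a', b, b'). a \<in> A \<and> a' \<in> A \<and> b \<in> B \<and> b' \<in> B \<and>
             [a - a' = \<xi> * (b - b')] (mod int p)}) \<le> (int p - 1) * K + K\<^sup>2"
    using exists_dilate_few_coincidences[OF assms(1) A B] unfolding K_def by auto
  define E where "E = {(a, a', b, b'). a \<in> A \<and> a' \<in> A \<and> b \<in> B \<and> b' \<in> B \<and>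
             [a - a' = \<xi> * (b - b')] (mod int p)}"
  have finE: "finite E"
    by (rule finite_subset[of _ "A \<times> A \<times> B \<times> B"]) (use fin in \<open>auto simp: E_def\<close>)
  define X where "X \<sigma> = (\<lambda>(a, b). (a + \<sigma> * \<xi> * b) mod int p) ` (A \<times> B)" for \<sigma>
  have X_sub: "X \<sigma> \<subseteq> {0..<int p}" for \<sigma>
    using p by (auto simp: X_def)
  have X_mem: "\<exists>a\<in>A. \<exists>b\<in>B. z = (a + \<sigma> * \<xi> * b) mod int p" if "z \<in> X \<sigma>" for z \<sigma>
    using that by (auto simp: X_def)
  have X_large: "2 * int (card (X \<sigma>)) > int p" if \<sigma>: "\<sigma> = 1 \<or> \<sigma> = -1" for \<sigma>
  proof -
    define Co where "Co = {(x, y) \<in> (A \<times> B) \<times> (A \<times> B).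
      (\<lambda>(a, b). (a + \<sigma> * \<xi> * b) mod int p) x = (\<lambda>(a, b). (a + \<sigma> * \<xi> * b) mod int p) y}"
    \<comment> \<open>For \<sigma> = 1 a collision reads \<open>a - a' = \<xi> * (b' - b)\<close>,
      hence the swap. Both signs are thus controlled by the same \<open>E\<close>, so that one \<xi>
      serves for both.\<close>
    define \<phi> where "\<phi> = (\<lambda>((a::int, b::int), (a'::int, b'::int)).
        if \<sigma> = 1 then (a, a', b', b) else (a, a', b, b'))"
    have "card Co \<le> card E"
    proof (rule card_inj_on_le[OF _ _ finE])
      show "inj_on \<phi> Co"
        by (auto simp: inj_on_def \<phi>_def split: if_splits)
      show "\<phi> ` Co \<subseteq> E"
        using \<sigma> by (auto simp: \<phi>_def Co_def E_def cong_iff_dvd_diff mod_eq_dvd_iff algebra_simps)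
    qed
    moreover have "(card (A \<times> B))\<^sup>2 \<le> card (X \<sigma>) * card Co"
      unfolding X_def Co_def using fin by (intro card_squared_le_card_image_collisions) auto
    ultimately have "(card A * card B)\<^sup>2 \<le> card (X \<sigma>) * card E"
      by (metis card_cartesian_product le_trans mult_le_mono2)
    then have "int ((card A * card B)\<^sup>2) \<le> int (card (X \<sigma>) * card E)"
      by (simp only: of_nat_le_iff)
    then have cs: "K\<^sup>2 \<le> int (card (X \<sigma>)) * int (card E)"
      by (simp add: K_def)
    show ?thesis
    proof (rule ccontr)
      assume "\<not> ?thesis"
      then have small: "2 * int (card (X \<sigma>)) \<le> int p" by simp
      \<comment> \<open>If \<open>X \<sigma>\<close> had at most p/2 elements, cancelling
        \<open>K\<close> would give (q - 1) K \<le> (q + 1) q; but K \<ge> 2 (q + 1) + 1, which is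
        too large once q \<ge> 2.\<close>
      define q where "q = int p - 1"
      have q: "q \<ge> 2" "int p = q + 1" using p by (auto simp: q_def)
      have "2 * (q * K\<^sup>2) \<le> 2 * (q * (int (card (X \<sigma>)) * int (card E)))"
        using cs q by (intro mult_left_mono) auto
      also have "\<dots> = (2 * int (card (X \<sigma>))) * (q * int (card E))"
        by simp
      also have "\<dots> \<le> int p * (q * int (card E))"
        using small q by (intro mult_right_mono) auto
      also have "\<dots> \<le> int p * (q * K + K\<^sup>2)"
        using few by (intro mult_left_mono) (auto simp: q_def E_def)
      finally have "2 * q * K\<^sup>2 \<le> (q + 1) * (q * K + K\<^sup>2)"
        by (simp add: q)
      then have "K * ((q - 1) * K) \<le> K * ((q + 1) * q)"
        by (simp add: algebra_simps power2_eq_square)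
      then have "(q - 1) * K \<le> (q + 1) * q"
        using K p by (subst (asm) mult_le_cancel_left_pos) auto
      moreover have "(q - 1) * K \<ge> (q - 1) * (2 * (q + 1) + 1)"
        using q K by (intro mult_left_mono) auto
      moreover have "(q - 1) * (2 * (q + 1) + 1) > (q + 1) * q"
      proof -
        have "q * q \<ge> 2 * 2" using q by (intro mult_mono) auto
        then show ?thesis using q by (simp add: algebra_simps)
      qed
      ultimately show False by linarith
    qed
  qed
  obtain x y where "x \<in> X (-1)" "y \<in> X (-1)" and xy: "[x + y = 0] (mod int p)"
    using X_large[of "-1"] residue_sumset_cover[OF _ X_sub X_sub, of "-1" "-1" 0] p by auto
  then obtain a1 a2 b1 b2 where mem: "a1 \<in> A" "a2 \<in> A" "b1 \<in> B" "b2 \<in> B"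
    and x: "x = (a1 + - 1 * \<xi> * b1) mod int p" and y: "y = (a2 + - 1 * \<xi> * b2) mod int p"
    using X_mem by metis
  have "[(a1 - \<xi> * b1) + (a2 - \<xi> * b2) = 0] (mod int p)"
    using xy unfolding x y by (simp add: unique_euclidean_semiring_class.cong_def mod_simps)
  then have quot: "[a1 + a2 = \<xi> * (b1 + b2)] (mod int p)"
    by (simp add: cong_iff_dvd_diff algebra_simps)
  have "coprime (b1 + b2) (int p)"
    using antisym[OF mem(3,4)] assms(1)
    by (simp add: coprime_commute prime_imp_coprime)
  then obtain u where "[(b1 + b2) * u = 1] (mod int p)"
    using cong_solve_coprime_int by blast
  then have u: "[(b1 + b2) * (u * l) = l] (mod int p)"
    by (metis cong_scalar_right mult.assoc mult_1)
  \<comment> \<open>The target is \<open>u * l\<close> with \<open>u\<close> the inverse of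
    \<open>b1 + b2\<close>, so that clearing the denominator of \<xi> leaves exactly
    \<open>l\<close>.\<close>
  obtain x' y' where "x' \<in> X 1" "y' \<in> X 1" and xy': "[x' + y' = u * l] (mod int p)"
    using X_large[of 1] residue_sumset_cover[OF _ X_sub X_sub, of 1 1 "u * l"] p by auto
  then obtain a3 a4 b3 b4 where mem': "a3 \<in> A" "a4 \<in> A" "b3 \<in> B" "b4 \<in> B"
    and x': "x' = (a3 + 1 * \<xi> * b3) mod int p" and y': "y' = (a4 + 1 * \<xi> * b4) mod int p"
    using X_mem by metis
  have s: "[(a3 + \<xi> * b3) + (a4 + \<xi> * b4) = u * l] (mod int p)"
    using xy' unfolding x' y' by (simp add: unique_euclidean_semiring_class.cong_def mod_simps)
  have "[(a1 + a2) * (b3 + b4) + (a3 + a4) * (b1 + b2)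
      = \<xi> * (b1 + b2) * (b3 + b4) + (a3 + a4) * (b1 + b2)] (mod int p)"
    using quot by (intro cong_add cong_mult) auto
  also have "\<xi> * (b1 + b2) * (b3 + b4) + (a3 + a4) * (b1 + b2)
      = (b1 + b2) * ((a3 + \<xi> * b3) + (a4 + \<xi> * b4))"
    by (simp add: algebra_simps)
  also have "[\<dots> = (b1 + b2) * (u * l)] (mod int p)"
    using s by (intro cong_mult) auto
  also note u
  finally show thesis
    using that mem mem' by blast
qed

subsection \<open>A lower bound for the prime counting function\<close>

text \<open>The witness is the least common multiple of 1, ..., N: the product over the primes of
  their largest powers not exceeding \<open>N\<close>, each factor being at most
  \<open>N\<close>.\<close>

lemma exists_common_multiple_le_power_primepi:
  fixes N :: nat
  assumes "N \<ge> 1"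
  obtains L where "L > 0" and "\<And>i. i \<in> {1..N} \<Longrightarrow> i dvd L"
    and "L \<le> N ^ card {p. prime p \<and> p \<le> N}"
proof -
  define P where "P = {p::nat. prime p \<and> p \<le> N}"
  have finP: "finite P" by (simp add: P_def)
  have "\<exists>e. p ^ e \<le> N \<and> N < p ^ (e + 1)" if "p \<in> P" for p
    using that assms by (intro ex_power_ivl1) (auto simp: P_def prime_ge_2_nat)
  then obtain e where e: "\<And>p. p \<in> P \<Longrightarrow> p ^ e p \<le> N \<and> N < p ^ (e p + 1)"
    by metis
  define L where "L = (\<Prod>p\<in>P. p ^ e p)"
  have "L > 0"
    unfolding L_def by (intro prod_pos) (auto simp: P_def prime_gt_0_nat)
  moreover have "i dvd L" if i: "i \<in> {1..N}" for i
  proof -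
    have "(\<Prod>q\<in>prime_factors i. q ^ multiplicity q i) dvd L"
      unfolding L_def
    proof (rule prod_dvd_prod_subset2[OF finP])
      show sub: "prime_factors i \<subseteq> P"
        using i by (auto simp: P_def in_prime_factors_iff dest!: dvd_imp_le)
      fix q assume q: "q \<in> prime_factors i"
      have "q ^ multiplicity q i \<le> i"
        using i by (intro dvd_imp_le multiplicity_dvd) auto
      also have "i < q ^ (e q + 1)"
        using i e[of q] q sub by (meson atLeastAtMost_iff le_less_trans subsetD)
      finally have less: "q ^ multiplicity q i < q ^ (e q + 1)" .
      have "q > 1"
        using q by (meson in_prime_factors_imp_prime prime_gt_1_nat)
      then have "multiplicity q i < e q + 1"
        using less by (rule power_less_imp_less_exp)
      then show "q ^ multiplicity q i dvd q ^ e q"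
        by (intro le_imp_power_dvd) simp
    qed
    then show ?thesis
      using i prime_factorization_nat[of i] by simp
  qed
  moreover have "L \<le> (\<Prod>p\<in>P. N)"
    unfolding L_def using e by (intro prod_mono) auto
  then have "L \<le> N ^ card P" by simp
  ultimately show thesis
    using that unfolding P_def by blast
qed

text \<open>The induction step is the recursion for the Beta integrals
  \<open>\<integral> x\<^sup>m\<^sup>-\<^sup>1 (1 - x)\<^sup>n\<^sup>-\<^sup>m dx = 1 / (m (n choose m))\<close> over the unit interval.\<close>

lemma mult_binomial_dvd_common_multiple:
  fixes L N :: nat
  assumes L: "\<And>i. i \<in> {1..N} \<Longrightarrow> i dvd L"
  shows "1 \<le> m \<Longrightarrow> m \<le> n \<Longrightarrow> n \<le> N \<Longrightarrow> m * (n choose m) dvd L"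
proof (induction m arbitrary: n rule: nat_induct_at_least)
  case base
  then show ?case using L by simp
next
  case (Suc m)
  then obtain n' where n': "n = Suc n'" "m \<le> n'"
    by (cases n) auto
  obtain z1 where z1: "L = m * (n' choose m) * z1"
    using Suc n' by (meson dvd_def Suc_leD order_trans le_SucI le_refl)
  obtain z2 where z2: "L = m * (n choose m) * z2"
    using Suc n' by (meson dvd_def Suc_leD)
  have pos: "(n' choose m) > 0" "(n choose m) > 0" "m > 0"
    using n' Suc by auto
  have absorb: "(real n - real m) * real (n choose m) = real n * real (n' choose m)"
  proof -
    have "(n - m) * (n choose m) = n * (n' choose m)"
      using binomial_absorb_comp[of n m] n' by simp
    then have "real ((n - m) * (n choose m)) = real (n * (n' choose m))"
      by simp
    moreover have "real (n - m) = real n - real m"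
      using n' by simp
    ultimately show ?thesis
      by (simp only: of_nat_mult)
  qed
  have top: "real (Suc m) * real (n choose Suc m) = real n * real (n' choose m)"
    using Suc_times_binomial[of m n'] n' by (metis of_nat_mult)
  \<comment> \<open>By the Beta recursion, the reciprocal of \<open>Suc m * (n choose Suc m)\<close>
    is the difference of the reciprocals of \<open>m * (n' choose m)\<close> and
    \<open>m * (n choose m)\<close>. Multiplied by \<open>L\<close>, these become the integers
    \<open>z1\<close> and \<open>z2\<close>.\<close>
  have "int L = int (Suc m * (n choose Suc m)) * (int z1 - int z2)"
  proof -
    have r1: "real L = real m * real (n' choose m) * real z1"
      using arg_cong[OF z1, of real] by simp
    have r2: "real L = real m * real (n choose m) * real z2"
      using arg_cong[OF z2, of real] by simp
    have "real m * (real n * real (n' choose m) * (real z1 - real z2))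
        = real n * (real m * real (n' choose m) * real z1)
          - real m * (real n * real (n' choose m)) * real z2"
      by (simp add: algebra_simps)
    also have "\<dots> = real n * real L - (real n - real m) * (real m * real (n choose m) * real z2)"
      unfolding absorb[symmetric] r1[symmetric] by (simp add: algebra_simps)
    also have "\<dots> = real m * real L"
      unfolding r2[symmetric] by (simp add: algebra_simps)
    finally have "real L = real (Suc m) * real (n choose Suc m) * (real z1 - real z2)"
      using pos top by simp
    then have "real_of_int (int L) = real_of_int (int (Suc m * (n choose Suc m)) * (int z1 - int z2))"
      by (simp only: of_int_mult of_int_diff of_int_of_nat_eq of_nat_mult)
    then show ?thesis
      by (simp only: of_int_eq_iff)
  qed
  then have "int (Suc m * (n choose Suc m)) dvd int L"
    by (rule dvdI)
  then show ?case
    by (simp only: int_dvd_int_iff)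
qed

text \<open>Chebyshev's bound by Nair's argument: the common multiple, at most \<open>N ^ r\<close>,
  is divisible by \<open>m * (2 * m choose m)\<close>, which is at least
  \<open>4 ^ m / 2\<close>.\<close>

lemma primepi_lower_bound:
  fixes N :: nat
  assumes "N \<ge> 2"
  shows "(real N - 2) * ln 2 \<le> real (card {p. prime p \<and> p \<le> N}) * ln (real N)"
proof -
  define r where "r = card {p. prime p \<and> p \<le> N}"
  obtain L where L: "L > 0" "\<And>i. i \<in> {1..N} \<Longrightarrow> i dvd L" "L \<le> N ^ r"
    using assms exists_common_multiple_le_power_primepi[of N] by (auto simp: r_def)
  \<comment> \<open>Rounding costs one \<open>ln 2\<close>, as 2m \<ge> N - 1, and halving
    \<open>4 ^ m\<close> costs another; hence \<open>N - 2\<close> in the bound.\<close>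
  define m where "m = N div 2"
  have m: "m \<ge> 1" "2 * m \<le> N" "N \<le> 2 * m + 1"
    using assms by (auto simp: m_def)
  have "m * (2 * m choose m) dvd L"
    using L(2) m by (intro mult_binomial_dvd_common_multiple[of N]) auto
  then have "m * (2 * m choose m) \<le> N ^ r"
    using L by (meson dvd_imp_le order_trans)
  then have "real (m * (2 * m choose m)) \<le> real (N ^ r)"
    by (simp only: of_nat_le_iff)
  moreover have "4 ^ m / 2 \<le> real (m * (2 * m choose m))"
    using central_binomial_lower_bound[of m] m by (simp add: field_simps)
  ultimately have "4 ^ m \<le> 2 * real N ^ r"
    by simp
  then have "ln ((4::real) ^ m) \<le> ln (2 * real N ^ r)"
    using assms by (subst ln_le_cancel_iff) auto
  then have "real m * ln 4 \<le> ln 2 + real r * ln (real N)"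
    using assms by (simp add: ln_mult ln_realpow)
  moreover have "ln (4::real) = 2 * ln 2"
    using ln_realpow[of 2 2] by simp
  moreover have "(real N - 1) * ln 2 \<le> (2 * real m) * ln 2"
    using m by (intro mult_right_mono) auto
  ultimately show ?thesis
    unfolding r_def by (simp add: algebra_simps)
qed

subsection \<open>Fibonacci and Lucas numbers\<close>

text \<open>This equals the usual F_{n+1} + F_{n-1}, but needs no predecessor and gives the correct
  value 2 at \<open>n = 0\<close>.\<close>

definition lucas :: "nat \<Rightarrow> int" where
  "lucas n = 2 * int (fib (Suc n)) - int (fib n)"

text \<open>With \<open>m\<close> fixed, both sides satisfy the Fibonacci recursion in d = n - m, so
  d = 0 (the doubling formula) and d = 1 suffice. The latter is Cassini's identity, whose sign is
  fixed by \<open>m\<close> being odd.\<close>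

lemma fib_odd_times_lucas:
  assumes "odd m" and "m \<le> n"
  shows "int (fib m) * lucas n = int (fib (n + m)) + int (fib (n - m))"
proof -
  have "int (fib m) * lucas (m + d) = int (fib (2 * m + d)) + int (fib d)" for d
  proof (induction d rule: fib.induct)
    case 1
    obtain k where k: "m = Suc k" using assms by (cases m) auto
    have dbl: "2 * m = Suc (k + m)" and suc: "fib (Suc m) = fib m + fib k"
      using k by auto
    have "fib (2 * m) = fib m * (fib (Suc m) + fib k)"
      unfolding dbl fib_add k[symmetric] by (simp only: distrib_left mult.commute)
    moreover have "lucas m = int (fib (Suc m) + fib k)"
      using suc by (simp add: lucas_def)
    ultimately show ?case
      by simp
  next
    case 2
    have "fib (Suc (m + m)) = fib (Suc m) * fib (Suc m) + fib m * fib m"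
      by (rule fib_add)
    moreover have "fib (Suc (Suc m)) * fib m = fib (Suc m) * fib (Suc m) + 1"
      using fib_Cassini_nat[of m] assms by (simp add: power2_eq_square)
    ultimately have "int (fib (Suc (m + m))) = int (fib (Suc m)) * int (fib (Suc m)) + int (fib m) * int (fib m)"
      "int (fib (Suc (Suc m))) * int (fib m) = int (fib (Suc m)) * int (fib (Suc m)) + 1"
      by (metis of_nat_add of_nat_mult of_nat_1)+
    moreover have dbl: "2 * m + Suc 0 = Suc (m + m)" by simp
    ultimately show ?case
      unfolding dbl by (simp add: lucas_def algebra_simps)
  next
    case (3 d)
    then show ?case
      by (simp add: lucas_def algebra_simps)
  qed
  from this[of "n - m"] show ?thesis
    using assms(2) by (simp add: mult_2 add.commute)
qed

lemma fib_Suc_le_power_2: "fib (Suc n) \<le> 2 ^ n"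
proof (induction n)
  case (Suc n)
  have "fib n \<le> fib (Suc n)" by (rule fib_Suc_mono)
  with Suc show ?case by simp
qed simp

lemma lucas_pos: "lucas n > 0"
  using fib_Suc_mono[of n] fib_neq_0_nat[of "Suc n"] by (simp add: lucas_def)

lemma lucas_le: "lucas n \<le> 2 ^ Suc n"
proof -
  have "int (fib (Suc n)) \<le> 2 ^ n"
    using fib_Suc_le_power_2[of n] by (metis of_nat_le_iff of_nat_numeral of_nat_power)
  then have "2 * int (fib (Suc n)) - int (fib n) \<le> 2 * 2 ^ n" by linarith
  then show ?thesis by (simp add: lucas_def)
qed

text \<open>Monotonicity starts at index 1, because L_0 = 2 exceeds L_1 = 1.\<close>

lemma lucas_strict_mono:
  assumes "1 \<le> m" and "m < n"
  shows "lucas m < lucas n"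
proof -
  have step: "lucas (Suc k) < lucas (Suc (Suc k))" for k
    using fib_Suc_mono[of k] fib_neq_0_nat[of "Suc k"] by (simp add: lucas_def)
  have "m - 1 < n - 1"
    using assms by linarith
  with step have "lucas (Suc (m - 1)) < lucas (Suc (n - 1))"
    by (rule lift_Suc_mono_less[where f = "\<lambda>k. lucas (Suc k)"])
  then show ?thesis using assms by simp
qed

text \<open>The first \<open>M\<close> odd-indexed Fibonacci numbers telescope to
  \<open>fib (2 * M)\<close>, so each term exceeds any sum of distinct earlier ones.\<close>

lemma sum_odd_fib_less:
  assumes "S \<subseteq> {..<M}"
  shows "(\<Sum>j\<in>S. fib (2 * j + 1)) < fib (2 * M + 1)"
proof -
  have "(\<Sum>j\<in>S. fib (2 * j + 1)) \<le> (\<Sum>j<M. fib (2 * j + 1))"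
    using assms by (intro sum_mono2) auto
  also have "\<dots> = fib (2 * M)"
    by (induction M) auto
  also have "\<dots> < fib (2 * M + 1)"
    by (cases M) (auto simp: fib_neq_0_nat)
  finally show ?thesis .
qed

text \<open>The sequence is superincreasing: the size of the sum reveals whether the top index is
  present, and removing it reduces to the previous \<open>M\<close>.\<close>

lemma inj_on_sum_odd_fib: "inj_on (\<lambda>S. \<Sum>j\<in>S. fib (2 * j + 1)) (Pow {..<M})"
proof (induction M)
  case 0
  then show ?case by (simp add: inj_on_def)
next
  case (Suc M)
  have top: "M \<in> S \<longleftrightarrow> (\<Sum>j\<in>S. fib (2 * j + 1)) \<ge> fib (2 * M + 1)"
    if "S \<subseteq> {..<Suc M}" for S
  proof
    assume "M \<in> S"
    then show "(\<Sum>j\<in>S. fib (2 * j + 1)) \<ge> fib (2 * M + 1)"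
      using that by (intro member_le_sum) (auto intro: finite_subset)
  next
    assume "(\<Sum>j\<in>S. fib (2 * j + 1)) \<ge> fib (2 * M + 1)"
    then show "M \<in> S"
      using sum_odd_fib_less[of S M] that unfolding lessThan_Suc by fastforce
  qed
  show ?case
  proof (rule inj_onI)
    fix S T assume ST: "S \<in> Pow {..<Suc M}" "T \<in> Pow {..<Suc M}"
      and eq: "(\<Sum>j\<in>S. fib (2 * j + 1)) = (\<Sum>j\<in>T. fib (2 * j + 1))"
    have fin: "finite S" "finite T"
      using ST finite_subset by blast+
    have mem: "M \<in> S \<longleftrightarrow> M \<in> T"
      using top[of S] top[of T] ST unfolding eq by blast
    have "(\<Sum>j\<in>S - {M}. fib (2 * j + 1)) = (\<Sum>j\<in>T - {M}. fib (2 * j + 1))"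
      using eq mem fin by (simp add: sum_diff1_nat)
    moreover have "S - {M} \<in> Pow {..<M}" "T - {M} \<in> Pow {..<M}"
      using ST by (auto simp: less_Suc_eq)
    ultimately have "S - {M} = T - {M}"
      using Suc.IH by (auto dest: inj_onD)
    then show "S = T"
      using mem by blast
  qed
qed

subsection \<open>Covering all residues for most primes\<close>

text \<open>Lists allow repeated terms and keep their number exact; concatenation then adds the
  counts.\<close>

definition fib_sums :: "nat \<Rightarrow> nat \<Rightarrow> int set" where
  "fib_sums I t = {(\<Sum>n\<leftarrow>ns. int (fib n)) | ns. length ns = t \<and> set ns \<subseteq> {1..I}}"

lemma fib_sums_add:
  assumes "x \<in> fib_sums I t" and "y \<in> fib_sums I u"
  shows "x + y \<in> fib_sums I (t + u)"
proof -
  obtain ns ms where "x = (\<Sum>n\<leftarrow>ns. int (fib n))" "length ns = t" "set ns \<subseteq> {1..I}"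
    "y = (\<Sum>n\<leftarrow>ms. int (fib n))" "length ms = u" "set ms \<subseteq> {1..I}"
    using assms by (auto simp: fib_sums_def)
  then show ?thesis
    unfolding fib_sums_def by (intro CollectI exI[of _ "ns @ ms"]) auto
qed

lemma fib_mem_fib_sums:
  assumes "1 \<le> n" and "n \<le> I"
  shows "int (fib n) \<in> fib_sums I 1"
  unfolding fib_sums_def using assms by (intro CollectI exI[of _ "[n]"]) auto

text \<open>Each product of an odd-indexed Fibonacci number with \<open>lucas n\<close> splits into
  two Fibonacci numbers; \<open>2 * M \<le> n\<close> keeps the smaller index positive.\<close>

lemma sum_odd_fib_times_lucas_mem_fib_sums:
  assumes "S \<subseteq> {..<M}" and "2 * M \<le> n" and "n + 2 * M \<le> I"
  shows "int (\<Sum>j\<in>S. fib (2 * j + 1)) * lucas n \<in> fib_sums I (2 * card S)"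
proof -
  have "finite S" using assms(1) finite_subset by blast
  then show ?thesis using assms(1)
  proof (induction S rule: finite_induct)
    case empty
    then show ?case by (simp add: fib_sums_def)
  next
    case (insert j S)
    have j: "2 * j + 1 \<le> n" "1 \<le> n - (2 * j + 1)" "n + (2 * j + 1) \<le> I"
      using insert.prems assms(2,3) by auto
    have "int (fib (2 * j + 1)) * lucas n
        = int (fib (n + (2 * j + 1))) + int (fib (n - (2 * j + 1)))"
      using j by (intro fib_odd_times_lucas) auto
    moreover have "\<dots> \<in> fib_sums I (1 + 1)"
      using j by (intro fib_sums_add fib_mem_fib_sums) auto
    ultimately have "int (fib (2 * j + 1)) * lucas n \<in> fib_sums I (1 + 1)"
      by simp
    moreover have "int (\<Sum>j\<in>S. fib (2 * j + 1)) * lucas n \<in> fib_sums I (2 * card S)"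
      using insert by auto
    ultimately have "int (fib (2 * j + 1)) * lucas n + int (\<Sum>j\<in>S. fib (2 * j + 1)) * lucas n
        \<in> fib_sums I (1 + 1 + 2 * card S)"
      by (rule fib_sums_add)
    then show ?case
      using insert by (simp add: distrib_right)
  qed
qed

text \<open>This feeds \<open>eight_products_cover\<close>: \<open>diff\<close> gives the Lucas
  residues their full number \<open>J\<close>, and \<open>sum\<close> is the antisymmetry
  condition.\<close>

lemma fib_sums_cover_if_many_residues:
  fixes k M J N p :: nat and \<epsilon> :: real
  assumes "prime p"
    and large: "card ((\<lambda>S. int (\<Sum>j\<in>S. fib (2 * j + 1)) mod int p) ` {S. S \<subseteq> {..<M} \<and> card S = k}) * J > 2 * p"
    and sum: "\<And>n n'. n \<in> {2 * M..<2 * M + J} \<Longrightarrow> n' \<in> {2 * M..<2 * M + J} \<Longrightarrow>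
        \<not> int p dvd lucas n + lucas n'"
    and diff: "\<And>n n'. n \<in> {2 * M..<2 * M + J} \<Longrightarrow> n' \<in> {2 * M..<2 * M + J} \<Longrightarrow> n < n' \<Longrightarrow>
        \<not> int p dvd lucas n' - lucas n"
    and range: "real (4 * M + J) \<le> real N powr \<epsilon>"
  shows "fib_sums_cover (16 * k) \<epsilon> N p"
proof -
  define f where "f S = int (\<Sum>j\<in>S. fib (2 * j + 1))" for S
  define \<S> where "\<S> = {S. S \<subseteq> {..<M} \<and> card S = k}"
  define A where "A = (\<lambda>S. f S mod int p) ` \<S>"
  define B where "B = (\<lambda>n. lucas n mod int p) ` {2 * M..<2 * M + J}"
  have p: "int p > 0" using assms(1) prime_gt_0_nat by auto
  have "inj_on (\<lambda>n. lucas n mod int p) {2 * M..<2 * M + J}"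
  proof (rule linorder_inj_onI)
    fix n n' assume h: "n < n'" "n \<in> {2 * M..<2 * M + J}" "n' \<in> {2 * M..<2 * M + J}"
    show "lucas n mod int p \<noteq> lucas n' mod int p"
      using diff[OF h(2,3,1)] by (metis mod_eq_dvd_iff)
  qed auto
  then have "card B = J"
    unfolding B_def by (simp add: card_image)
  have cover: "l mod int p \<in> (\<lambda>x. x mod int p) ` fib_sums (4 * M + J) (16 * k)" for l
  proof -
    obtain a1 a2 a3 a4 b1 b2 b3 b4 where A: "{a1, a2, a3, a4} \<subseteq> A" and B: "{b1, b2, b3, b4} \<subseteq> B"
      and l: "[(a1 + a2) * (b3 + b4) + (a3 + a4) * (b1 + b2) = l] (mod int p)"
    proof (rule eight_products_cover[OF assms(1), of A B l])
      show "A \<subseteq> {0..<int p}" "B \<subseteq> {0..<int p}"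
        using p by (auto simp: A_def B_def)
      show "2 * p < card A * card B"
        using large \<open>card B = J\<close> by (simp add: A_def f_def \<S>_def)
      show "\<not> int p dvd b + b'" if "b \<in> B" "b' \<in> B" for b b'
        using that sum by (auto simp: B_def dvd_eq_mod_eq_0 mod_simps)
    qed blast
    have "\<exists>S\<in>\<S>. a = f S mod int p" if "a \<in> A" for a
      using that by (auto simp: A_def)
    then obtain S1 S2 S3 S4 where S: "S1 \<in> \<S>" "S2 \<in> \<S>" "S3 \<in> \<S>" "S4 \<in> \<S>"
      and a: "a1 = f S1 mod int p" "a2 = f S2 mod int p" "a3 = f S3 mod int p" "a4 = f S4 mod int p"
      using A by (metis insert_subset)
    have "\<exists>n\<in>{2 * M..<2 * M + J}. b = lucas n mod int p" if "b \<in> B" for b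
      using that by (auto simp: B_def)
    then obtain n1 n2 n3 n4 where n: "n1 \<in> {2 * M..<2 * M + J}" "n2 \<in> {2 * M..<2 * M + J}"
        "n3 \<in> {2 * M..<2 * M + J}" "n4 \<in> {2 * M..<2 * M + J}"
      and b: "b1 = lucas n1 mod int p" "b2 = lucas n2 mod int p"
        "b3 = lucas n3 mod int p" "b4 = lucas n4 mod int p"
      using B by (metis insert_subset)
    have mem: "f S * lucas n \<in> fib_sums (4 * M + J) (2 * k)"
      if "S \<in> \<S>" "n \<in> {2 * M..<2 * M + J}" for S n
      using that sum_odd_fib_times_lucas_mem_fib_sums[of S M n "4 * M + J"]
      by (auto simp: \<S>_def f_def)
    \<comment> \<open>Expanding yields eight products of \<open>2 * k\<close> Fibonacci terms each,
      whence \<open>16 * k\<close>.\<close>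
    define x where "x = (f S1 * lucas n3 + f S1 * lucas n4 + (f S2 * lucas n3 + f S2 * lucas n4))
      + (f S3 * lucas n1 + f S3 * lucas n2 + (f S4 * lucas n1 + f S4 * lucas n2))"
    have "x \<in> fib_sums (4 * M + J)
        (2 * k + 2 * k + (2 * k + 2 * k) + (2 * k + 2 * k + (2 * k + 2 * k)))"
      unfolding x_def using S n by (intro fib_sums_add mem)
    then have "x \<in> fib_sums (4 * M + J) (16 * k)"
      by simp
    have x: "x = (f S1 + f S2) * (lucas n3 + lucas n4) + (f S3 + f S4) * (lucas n1 + lucas n2)"
      by (simp add: x_def algebra_simps)
    have "[(a1 + a2) * (b3 + b4) + (a3 + a4) * (b1 + b2) = x] (mod int p)"
      unfolding a b x by (intro cong_add cong_mult) simp_all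
    then have "x mod int p = l mod int p"
      using l unfolding unique_euclidean_semiring_class.cong_def by simp
    with \<open>x \<in> fib_sums (4 * M + J) (16 * k)\<close> show ?thesis
      by (metis image_eqI)
  qed
  show ?thesis
    unfolding fib_sums_cover_def
  proof
    fix l :: int
    obtain ns where len: "length ns = 16 * k" and ns: "set ns \<subseteq> {1..4 * M + J}"
      and eq: "(\<Sum>n\<leftarrow>ns. int (fib n)) mod int p = l mod int p"
      using cover[of l] by (auto simp: fib_sums_def)
    have "1 \<le> ns ! i \<and> real (ns ! i) \<le> real N powr \<epsilon>" if "i < 16 * k" for i
    proof -
      have "ns ! i \<in> {1..4 * M + J}"
        using nth_mem[of i ns] that len ns by (simp add: subset_iff)
      then have "1 \<le> ns ! i" and "real (ns ! i) \<le> real (4 * M + J)"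
        unfolding of_nat_le_iff by auto
      then show ?thesis
        using range by linarith
    qed
    moreover have "(\<Sum>n\<leftarrow>ns. int (fib n)) = (\<Sum>i<16 * k. int (fib (ns ! i)))"
      by (simp add: sum_list_sum_nth len atLeast0LessThan)
    ultimately show "\<exists>n. (\<forall>i<16 * k. 1 \<le> n i \<and> real (n i) \<le> real N powr \<epsilon>) \<and>
        [(\<Sum>i<16 * k. int (fib (n i))) = l] (mod int p)"
      using eq by (intro exI[of _ "\<lambda>i. ns ! i"]) (simp add: unique_euclidean_semiring_class.cong_def)
  qed
qed

text \<open>An uncovered prime has too many collisions among the subset sums (\<open>bad1\<close>)
  or divides a sum (\<open>bad2\<close>) or a difference (\<open>bad3\<close>) of Lucas numbers. The
  first kind accounts for \<open>Y\<close>, the other two for the remaining term.\<close>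

lemma card_primes_not_covered_le:
  fixes k M J N :: nat and \<epsilon> Y :: real
  assumes "Y > 0" and "M \<ge> 1" and choose: "M choose k \<ge> N" and "N \<ge> 1"
    and size: "(real J - 2) * Y > 4 * real N * real M"
    and range: "real (4 * M + J) \<le> real N powr \<epsilon>"
  shows "real (card {p. prime p \<and> p \<le> N \<and> \<not> fib_sums_cover (16 * k) \<epsilon> N p})
    \<le> Y + 2 * (real J)\<^sup>2 * (2 * real M + real J + 1)"
proof -
  define P where "P = {p::nat. prime p \<and> p \<le> N}"
  define I where "I = {2 * M..<2 * M + J}"
  define \<S> where "\<S> = {S. S \<subseteq> {..<M} \<and> card S = k}"
  define f where "f S = int (\<Sum>j\<in>S. fib (2 * j + 1))" for S
  define D where "D = {(S, T) \<in> \<S> \<times> \<S>. S \<noteq> T}"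
  define coll where "coll p = card {q \<in> D. int p dvd (\<lambda>(S, T). f S - f T) q}" for p
  \<comment> \<open>The numerator bounds the total number of collisions over all primes, so Markov's
    inequality with this threshold leaves at most \<open>Y\<close> bad primes.\<close>
  define C where "C = (real (card \<S>))\<^sup>2 * (2 * real M) / Y"
  \<comment> \<open>For \<open>n\<close> in \<open>I\<close> one has lucas n \<le> 2^(n+1) \<le>
    2^(2M+J); the extra 1 pays for adding two such numbers.\<close>
  define H where "H = 2 * M + J + 1"
  define bad1 where "bad1 = {p \<in> P. real (coll p) \<ge> C}"
  define bad2 where "bad2 = {p \<in> P. real (card {q \<in> I \<times> I. int p dvd (\<lambda>(m, n). lucas m + lucas n) q}) \<ge> 1}"
  define bad3 where "bad3 = {p \<in> P. real (card {q \<in> {(m, n) \<in> I \<times> I. m < n}. int p dvd (\<lambda>(m, n). lucas n - lucas m) q}) \<ge> 1}"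
  have finP: "finite P" "finite I" by (auto simp: P_def I_def)
  have primeP: "prime p" if "p \<in> P" for p using that by (simp add: P_def)
  have cardS: "card \<S> = M choose k"
    unfolding \<S>_def using n_subsets[of "{..<M}" k] by simp
  have finS: "finite \<S>"
    by (rule finite_subset[of _ "Pow {..<M}"]) (auto simp: \<S>_def)
  have finD: "finite D"
    by (rule finite_subset[of _ "\<S> \<times> \<S>"]) (use finS in \<open>auto simp: D_def\<close>)
  have posS: "card \<S> > 0" using cardS choose assms(4) by linarith
  have "C > 0" using posS assms(1,2) by (auto simp: C_def intro!: divide_pos_pos mult_pos_pos)
  have cardD: "card D \<le> (card \<S>)\<^sup>2"
    using card_mono[of "\<S> \<times> \<S>" D] finS unfolding D_def card_cartesian_product power2_eq_square
    by blast
  have injf: "inj_on f \<S>"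
  proof (rule inj_onI)
    fix S T assume "S \<in> \<S>" "T \<in> \<S>" "f S = f T"
    then show "S = T"
      unfolding \<S>_def f_def of_nat_eq_iff by (intro inj_onD[OF inj_on_sum_odd_fib[of M]]) auto
  qed
  have f_bound: "0 \<le> f S \<and> f S \<le> 2 ^ (2 * M)" if "S \<in> \<S>" for S
  proof -
    have "(\<Sum>j\<in>S. fib (2 * j + 1)) \<le> 2 ^ (2 * M)"
      using sum_odd_fib_less[of S M] fib_Suc_le_power_2[of "2 * M"] that by (simp add: \<S>_def)
    then have "int (\<Sum>j\<in>S. fib (2 * j + 1)) \<le> int (2 ^ (2 * M))"
      by (simp only: of_nat_le_iff)
    then show ?thesis unfolding f_def by (simp add: sum_nonneg)
  qed
  have "(\<Sum>p\<in>P. coll p) \<le> card D * (2 * M)"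
    unfolding coll_def
  proof (rule sum_card_prime_divisors_le[OF finP(1) primeP finD])
    fix q assume "q \<in> D"
    then obtain S T where q: "q = (S, T)" "S \<in> \<S>" "T \<in> \<S>" "S \<noteq> T"
      by (auto simp: D_def)
    show "(case q of (S, T) \<Rightarrow> f S - f T) \<noteq> 0"
      using q injf by (auto dest: inj_onD)
    show "\<bar>case q of (S, T) \<Rightarrow> f S - f T\<bar> \<le> 2 ^ (2 * M)"
      using f_bound[OF q(2)] f_bound[OF q(3)] unfolding q(1) prod.case by linarith
  qed
  also have "\<dots> \<le> (card \<S>)\<^sup>2 * (2 * M)"
    using cardD by simp
  finally have "real (card bad1) \<le> real ((card \<S>)\<^sup>2 * (2 * M)) / C"
    unfolding bad1_def by (intro card_ge_threshold_le finP \<open>C > 0\<close>)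
  also have "\<dots> = Y"
    using posS assms(1,2) by (auto simp: C_def intro!: divide_pos_pos mult_pos_pos)
  finally have bad1: "real (card bad1) \<le> Y" .
  have lucas_bound: "0 < lucas n \<and> 2 * lucas n \<le> 2 ^ H" if "n \<in> I" for n
  proof -
    have "(2::int) ^ Suc n \<le> 2 ^ (2 * M + J)"
      using that by (intro power_increasing) (auto simp: I_def)
    then show ?thesis
      using lucas_le[of n] lucas_pos[of n] by (simp add: H_def)
  qed
  have "(\<Sum>p\<in>P. card {q \<in> I \<times> I. int p dvd (\<lambda>(m, n). lucas m + lucas n) q}) \<le> card (I \<times> I) * H"
  proof (rule sum_card_prime_divisors_le[OF finP(1) primeP])
    fix q assume "q \<in> I \<times> I"
    then obtain m n where q: "q = (m, n)" "m \<in> I" "n \<in> I"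
      by auto
    show "(case q of (m, n) \<Rightarrow> lucas m + lucas n) \<noteq> 0"
      using lucas_bound[OF q(2)] lucas_bound[OF q(3)] unfolding q(1) prod.case by linarith
    show "\<bar>case q of (m, n) \<Rightarrow> lucas m + lucas n\<bar> \<le> 2 ^ H"
      using lucas_bound[OF q(2)] lucas_bound[OF q(3)] unfolding q(1) prod.case by linarith
  qed (use finP in auto)
  then have "real (card bad2) \<le> real (card (I \<times> I) * H) / 1"
    unfolding bad2_def by (intro card_ge_threshold_le finP) auto
  then have bad2: "real (card bad2) \<le> (real J)\<^sup>2 * real H"
    by (simp add: card_cartesian_product I_def power2_eq_square)
  have "(\<Sum>p\<in>P. card {q \<in> {(m, n) \<in> I \<times> I. m < n}. int p dvd (\<lambda>(m, n). lucas n - lucas m) q})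
      \<le> card {(m, n) \<in> I \<times> I. m < n} * H"
  proof (rule sum_card_prime_divisors_le[OF finP(1) primeP])
    show "finite {(m, n) \<in> I \<times> I. m < n}"
      by (rule finite_subset[of _ "I \<times> I"]) (use finP in auto)
    fix q assume "q \<in> {(m, n) \<in> I \<times> I. m < n}"
    then obtain m n where q: "q = (m, n)" "m \<in> I" "n \<in> I" "m < n"
      by auto
    \<comment> \<open>\<open>M \<ge> 1\<close> keeps the indices away from 0, where monotonicity
      fails.\<close>
    show "(case q of (m, n) \<Rightarrow> lucas n - lucas m) \<noteq> 0"
      using lucas_strict_mono[of m n] q assms(2) by (auto simp: I_def)
    show "\<bar>case q of (m, n) \<Rightarrow> lucas n - lucas m\<bar> \<le> 2 ^ H"
      using lucas_bound[OF q(2)] lucas_bound[OF q(3)] unfolding q(1) prod.case by linarith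
  qed
  also have "\<dots> \<le> card (I \<times> I) * H"
    using finP by (intro mult_right_mono card_mono) auto
  finally have "real (card bad3) \<le> real (card (I \<times> I) * H) / 1"
    unfolding bad3_def by (intro card_ge_threshold_le finP) auto
  then have bad3: "real (card bad3) \<le> (real J)\<^sup>2 * real H"
    by (simp add: card_cartesian_product I_def power2_eq_square)
  have covered: "fib_sums_cover (16 * k) \<epsilon> N p"
    if p: "p \<in> P" "p \<notin> bad1" "p \<notin> bad2" "p \<notin> bad3" for p
  proof (rule fib_sums_cover_if_many_residues[OF primeP[OF p(1)] _ _ _ range])
    define A where "A = (\<lambda>S. f S mod int p) ` \<S>"
    define s where "s = real (card \<S>)"
    \<comment> \<open>Collisions modulo \<open>p\<close> are the diagonal pairs together with those
      counted by \<open>coll p\<close>.\<close>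
    have "{(S, T) \<in> \<S> \<times> \<S>. f S mod int p = f T mod int p}
        \<subseteq> (\<lambda>S. (S, S)) ` \<S> \<union> {q \<in> D. int p dvd (\<lambda>(S, T). f S - f T) q}"
      by (auto simp: D_def mod_eq_dvd_iff)
    then have "card {(S, T) \<in> \<S> \<times> \<S>. f S mod int p = f T mod int p}
        \<le> card ((\<lambda>S. (S, S)) ` \<S> \<union> {q \<in> D. int p dvd (\<lambda>(S, T). f S - f T) q})"
      using finS finD by (intro card_mono) auto
    also have "\<dots> \<le> card ((\<lambda>S. (S, S)) ` \<S>) + coll p"
      unfolding coll_def by (rule card_Un_le)
    also have "\<dots> \<le> card \<S> + coll p"
      using finS by (simp add: card_image_le)
    finally have "(card \<S>)\<^sup>2 \<le> card A * (card \<S> + coll p)"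
      using card_squared_le_card_image_collisions[OF finS, of "\<lambda>S. f S mod int p"]
      unfolding A_def by (meson mult_le_mono2 order_trans)
    then have "real ((card \<S>)\<^sup>2) \<le> real (card A * (card \<S> + coll p))"
      by (simp only: of_nat_le_iff)
    then have "s\<^sup>2 \<le> real (card A) * (s + real (coll p))"
      by (simp add: s_def)
    also have "\<dots> \<le> real (card A) * (s + s\<^sup>2 * (2 * real M) / Y)"
      using p(1,2) by (intro mult_left_mono) (auto simp: bad1_def C_def s_def)
    finally have "s\<^sup>2 \<le> real (card A) * (s + s\<^sup>2 * (2 * real M) / Y)" .
    then have "s\<^sup>2 * Y \<le> real (card A) * (s + s\<^sup>2 * (2 * real M) / Y) * Y"
      using \<open>Y > 0\<close> by (intro mult_right_mono) auto
    also have "\<dots> = s * (real (card A) * (Y + 2 * real M * s))"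
      using \<open>Y > 0\<close> by (simp add: field_simps power2_eq_square)
    finally have "s * (s * Y) \<le> s * (real (card A) * (Y + 2 * real M * s))"
      by (simp add: power2_eq_square mult.assoc)
    moreover have "s > 0" using posS by (simp add: s_def)
    ultimately have sY: "s * Y \<le> real (card A) * (Y + 2 * real M * s)"
      by (simp only: mult_le_cancel_left_pos)
    have sN: "s \<ge> real N" using choose cardS by (simp add: s_def)
    \<comment> \<open>Here s \<ge> N trades 2NY for 2sY. Then \<open>size\<close> replaces 4NM by (J
      - 2) Y, and the two terms add up to J s Y.\<close>
    have "2 * real N * (Y + 2 * real M * s) \<le> 2 * s * Y + 4 * real N * real M * s"
      using sN \<open>Y > 0\<close> by (simp add: algebra_simps)
    also have "\<dots> < 2 * s * Y + (real J - 2) * Y * s"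
      using size \<open>s > 0\<close> by simp
    also have "\<dots> = real J * (s * Y)"
      by (simp add: algebra_simps)
    also have "\<dots> \<le> real J * (real (card A) * (Y + 2 * real M * s))"
      using sY by (intro mult_left_mono) auto
    finally have "2 * real N * (Y + 2 * real M * s) < (real J * real (card A)) * (Y + 2 * real M * s)"
      by simp
    then have "2 * real N < real J * real (card A)"
      using \<open>Y > 0\<close> \<open>s > 0\<close> by (subst (asm) mult_less_cancel_right_pos) (auto intro!: add_pos_nonneg)
    then have "real (2 * N) < real (card A * J)"
      by (simp add: mult.commute)
    then have "2 * N < card A * J"
      by (simp only: of_nat_less_iff)
    moreover have "p \<le> N" using p by (simp add: P_def)
    ultimately have "2 * p < card A * J"
      by linarith
    then show "2 * p < card ((\<lambda>S. int (\<Sum>j\<in>S. fib (2 * j + 1)) mod int p) `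
        {S. S \<subseteq> {..<M} \<and> card S = k}) * J"
      by (simp add: A_def \<S>_def f_def)
  next
    fix m n assume "m \<in> {2 * M..<2 * M + J}" "n \<in> {2 * M..<2 * M + J}"
    then have mem: "m \<in> I" "n \<in> I"
      by (simp_all add: I_def)
    have "{q \<in> I \<times> I. int p dvd (\<lambda>(m, n). lucas m + lucas n) q} = {}"
      using p(1,3) finP by (simp add: bad2_def not_le card_gt_0_iff)
    then have "(m, n) \<notin> {q \<in> I \<times> I. int p dvd (\<lambda>(m, n). lucas m + lucas n) q}"
      by (simp only: empty_iff not_False_eq_True)
    with mem show "\<not> int p dvd lucas m + lucas n"
      by simp
  next
    fix m n assume "m \<in> {2 * M..<2 * M + J}" "n \<in> {2 * M..<2 * M + J}" "m < n"
    then have mem: "m \<in> I" "n \<in> I" "m < n"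
      by (simp_all add: I_def)
    have fin: "finite {(m, n) \<in> I \<times> I. m < n}"
      by (rule finite_subset[of _ "I \<times> I"]) (use finP in auto)
    have "card {q \<in> {(m, n) \<in> I \<times> I. m < n}. int p dvd (\<lambda>(m, n). lucas n - lucas m) q} = 0"
      using p(1,4) unfolding bad3_def by fastforce
    then have "{q \<in> {(m, n) \<in> I \<times> I. m < n}. int p dvd (\<lambda>(m, n). lucas n - lucas m) q} = {}"
      using fin by (simp only: card_0_eq finite_Collect_conjI simp_thms Collect_mem_eq)
    then have "(m, n) \<notin> {q \<in> {(m, n) \<in> I \<times> I. m < n}. int p dvd (\<lambda>(m, n). lucas n - lucas m) q}"
      by (simp only: empty_iff not_False_eq_True)
    with mem show "\<not> int p dvd lucas n - lucas m"
      by simp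
  qed
  have "{p. prime p \<and> p \<le> N \<and> \<not> fib_sums_cover (16 * k) \<epsilon> N p} \<subseteq> bad1 \<union> bad2 \<union> bad3"
    using covered by (auto simp: P_def)
  then have "card {p. prime p \<and> p \<le> N \<and> \<not> fib_sums_cover (16 * k) \<epsilon> N p} \<le> card (bad1 \<union> bad2 \<union> bad3)"
    using finP by (intro card_mono) (auto simp: bad1_def bad2_def bad3_def)
  also have "\<dots> \<le> card bad1 + card bad2 + card bad3"
    by (meson card_Un_le add_le_mono1 order_trans)
  finally have "real (card {p. prime p \<and> p \<le> N \<and> \<not> fib_sums_cover (16 * k) \<epsilon> N p})
      \<le> real (card bad1) + real (card bad2) + real (card bad3)"
    by (metis of_nat_add of_nat_le_iff)
  also have "\<dots> \<le> Y + (real J)\<^sup>2 * real H + (real J)\<^sup>2 * real H"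
    using bad1 bad2 bad3 by linarith
  finally show ?thesis
    by (simp add: H_def algebra_simps)
qed

section \<open>Choice of the exponents and comparison with the prime counting function\<close>

theorem theorem4:
  fixes \<epsilon> :: real
  assumes "0 < \<epsilon>" and "\<epsilon> < 1/2"
  shows "\<exists>s::nat. real s < 100 / \<epsilon> \<and>
    (\<lambda>N. real (card {p::nat. prime p \<and> p \<le> N \<and> fib_sums_cover s \<epsilon> N p}))
      \<sim>[at_top] (\<lambda>N. real (card {p::nat. prime p \<and> p \<le> N}))"
proof -
  \<comment> \<open>The indices reach 4M + J, of order N^(2\<delta>), which lies below
    N^(4\<delta>), the allowed range.\<close>
  define \<delta> where "\<delta> = \<epsilon> / 4"
  \<comment> \<open>The added 1 makes 1/k < \<delta> strict, so that (M/k)^k eventually exceeds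
    \<open>N\<close>; still 16k < 64/\<epsilon> + 32 \<le> 100/\<epsilon>.\<close>
  define k where "k = nat \<lceil>1 / \<delta>\<rceil> + 1"
  define M where "M N = nat \<lfloor>real N powr \<delta>\<rfloor>" for N :: nat
  define J where "J N = nat \<lfloor>real N powr (2 * \<delta>)\<rfloor>" for N :: nat
  \<comment> \<open>The product J Y, of order N^(1 + 3\<delta>/2), beats 4NM, of order N^(1 +
    \<delta>), while \<open>Y\<close> still saves a power of \<open>N\<close>.\<close>
  define Y where "Y N = real N powr (1 - \<delta> / 2)" for N :: nat
  define U where "U x = x powr (1 - \<delta> / 2)
    + 2 * (x powr (2 * \<delta>))\<^sup>2 * (2 * x powr \<delta> + x powr (2 * \<delta>) + 1)" for x :: real
  define g where "g N = real (card {p::nat. prime p \<and> p \<le> N})" for N :: nat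
  define f where "f N = real (card {p::nat. prime p \<and> p \<le> N \<and> fib_sums_cover (16 * k) \<epsilon> N p})" for N
  define b where "b N = real (card {p::nat. prime p \<and> p \<le> N \<and> \<not> fib_sums_cover (16 * k) \<epsilon> N p})" for N
  have \<delta>: "0 < \<delta>" "\<delta> < 1 / 8"
    using assms by (auto simp: \<delta>_def)
  have "0 < 1 / \<delta>"
    using \<delta> by simp
  then have k: "1 / \<delta> < real k" "real k < 1 / \<delta> + 2"
    unfolding k_def by linarith+
  have "k \<ge> 1"
    by (simp add: k_def)
  then have \<beta>: "0 < 1 / real k" "1 / real k < \<delta>" "0 < real k"
    using \<delta> k(1) by (auto simp: field_simps)
  have "16 * real k < 100 / \<epsilon>"
  proof -
    have "16 * real k < 16 * (4 / \<epsilon> + 2)"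
      using k(2) by (simp add: \<delta>_def)
    also have "\<dots> = (64 + 32 * \<epsilon>) / \<epsilon>"
      using assms by (simp add: field_simps)
    also have "\<dots> \<le> 100 / \<epsilon>"
      using assms by (intro divide_right_mono) auto
    finally show ?thesis .
  qed
  have M: "real (M N) \<le> real N powr \<delta>" "real N powr \<delta> - 1 \<le> real (M N)" for N
  proof -
    have "real N powr \<delta> \<ge> 0" by simp
    then show "real (M N) \<le> real N powr \<delta>" "real N powr \<delta> - 1 \<le> real (M N)"
      unfolding M_def by linarith+
  qed
  have J: "real (J N) \<le> real N powr (2 * \<delta>)" "real N powr (2 * \<delta>) - 1 \<le> real (J N)" for N
  proof -
    have "real N powr (2 * \<delta>) \<ge> 0" by simp
    then show "real (J N) \<le> real N powr (2 * \<delta>)" "real N powr (2 * \<delta>) - 1 \<le> real (J N)"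
      unfolding J_def by linarith+
  qed
  note to_nat = eventually_compose_filterlim[OF _ filterlim_real_sequentially]
  \<comment> \<open>The 3 is the 2 of the size condition plus 1 for the floor in
    \<open>J\<close>.\<close>
  have "\<forall>\<^sub>F x::real in at_top. (x powr (2 * \<delta>) - 3) * x powr (1 - \<delta> / 2) > 4 * x * x powr \<delta>"
    using \<delta> by real_asymp
  note ev1 = to_nat[OF this]
  have "\<forall>\<^sub>F x::real in at_top. 4 * x powr \<delta> + x powr (2 * \<delta>) \<le> x powr (4 * \<delta>)"
    using \<delta> by real_asymp
  note ev2 = to_nat[OF this]
  have "\<forall>\<^sub>F x::real in at_top. (x powr \<delta> - 1) / real k \<ge> x powr (1 / real k)"
    using \<delta> \<beta> by real_asymp
  note ev3 = to_nat[OF this]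
  have "\<forall>\<^sub>F x::real in at_top. x powr \<delta> - 1 \<ge> real k"
    using \<delta> \<beta> by real_asymp
  note ev4 = to_nat[OF this]
  have bound: "\<forall>\<^sub>F N in at_top. b N \<le> U (real N)"
    using ev1 ev2 ev3 ev4 eventually_ge_at_top[of 1]
  proof eventually_elim
    case (elim N)
    have "real k \<le> real (M N)"
      using elim(4) M(2)[of N] by linarith
    then have "k \<le> M N" by simp
    have "real N = (real N powr (1 / real k)) ^ k"
      using elim(5) \<open>k \<ge> 1\<close> by (simp add: powr_realpow[symmetric] powr_powr)
    also have "\<dots> \<le> (real (M N) / real k) ^ k"
    proof (rule power_mono)
      have "(real N powr \<delta> - 1) / real k \<le> real (M N) / real k"
        using M(2)[of N] by (intro divide_right_mono) auto
      with elim(3) show "real N powr (1 / real k) \<le> real (M N) / real k"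
        by linarith
    qed simp
    also have "\<dots> \<le> real (M N choose k)"
      using \<open>k \<le> M N\<close> by (rule binomial_ge_n_over_k_pow_k)
    finally have "N \<le> M N choose k" by simp
    have "4 * real N * real (M N) \<le> 4 * real N * real N powr \<delta>"
      using M(1)[of N] by (intro mult_left_mono) auto
    also have "\<dots> < (real N powr (2 * \<delta>) - 3) * Y N"
      using elim(1) by (simp add: Y_def)
    also have "\<dots> \<le> (real (J N) - 2) * Y N"
      using J(2)[of N] by (intro mult_right_mono) (auto simp: Y_def)
    finally have size: "4 * real N * real (M N) < (real (J N) - 2) * Y N" .
    have "real (4 * M N + J N) \<le> 4 * real N powr \<delta> + real N powr (2 * \<delta>)"
      using M(1)[of N] J(1)[of N] by simp
    also have "\<dots> \<le> real N powr (4 * \<delta>)"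
      by (rule elim(2))
    finally have range: "real (4 * M N + J N) \<le> real N powr \<epsilon>"
      by (simp add: \<delta>_def)
    have "b N \<le> Y N + 2 * (real (J N))\<^sup>2 * (2 * real (M N) + real (J N) + 1)"
      unfolding b_def
    proof (rule card_primes_not_covered_le)
      show "Y N > 0" using elim(5) by (simp add: Y_def)
      show "M N \<ge> 1" using \<open>k \<ge> 1\<close> \<open>k \<le> M N\<close> by simp
    qed fact+
    also have "\<dots> \<le> U (real N)"
      unfolding U_def Y_def using M(1)[of N] J(1)[of N]
      by (intro add_mono mult_mono power_mono order_refl) auto
    finally show ?case .
  qed
  have "(\<lambda>N. b N / g N) \<longlonglongrightarrow> 0"
  proof (rule tendsto_sandwich)
    show "\<forall>\<^sub>F N in at_top. 0 \<le> b N / g N"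
      by (simp add: b_def g_def)
    show "\<forall>\<^sub>F N in at_top. b N / g N \<le> U (real N) * ln (real N) / ((real N - 2) * ln 2)"
      using bound eventually_gt_at_top[of 2]
    proof eventually_elim
      case (elim N)
      have pi: "(real N - 2) * ln 2 \<le> g N * ln (real N)"
        using primepi_lower_bound[of N] elim by (simp add: g_def)
      have pos: "(real N - 2) * ln 2 > 0" "ln (real N) > 0"
        using elim by auto
      have "b N / g N = b N * ln (real N) / (g N * ln (real N))"
        using pos by simp
      also have "\<dots> \<le> U (real N) * ln (real N) / ((real N - 2) * ln 2)"
        using elim(1) pi pos by (intro frac_le mult_right_mono mult_nonneg_nonneg)
          (auto simp: b_def U_def)
      finally show ?case .
    qed
    \<comment> \<open>The exponents in \<open>U\<close> are at most 1 - \<delta>/2 and 6\<delta> <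
      3/4, so the logarithm is absorbed.\<close>
    have "((\<lambda>x. U x * ln x / ((x - 2) * ln 2)) \<longlongrightarrow> 0) at_top"
      unfolding U_def using \<delta> by real_asymp
    then show "(\<lambda>N. U (real N) * ln (real N) / ((real N - 2) * ln 2)) \<longlonglongrightarrow> 0"
      by (rule filterlim_compose[OF _ filterlim_real_sequentially])
  qed simp
  then have "(\<lambda>N. 1 - b N / g N) \<longlonglongrightarrow> 1 - 0"
    by (intro tendsto_intros)
  moreover have "\<forall>\<^sub>F N in at_top. 1 - b N / g N = f N / g N"
    using eventually_ge_at_top[of 2]
  proof eventually_elim
    case (elim N)
    have "{p::nat. prime p \<and> p \<le> N}
        = {p. prime p \<and> p \<le> N \<and> fib_sums_cover (16 * k) \<epsilon> N p}
          \<union> {p. prime p \<and> p \<le> N \<and> \<not> fib_sums_cover (16 * k) \<epsilon> N p}"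
      by auto
    then have "g N = f N + b N"
      unfolding g_def f_def b_def by (simp only:) (subst card_Un_disjoint; auto)
    moreover have "2 \<in> {p::nat. prime p \<and> p \<le> N}"
      using elim by simp
    then have "g N > 0"
      unfolding g_def of_nat_0_less_iff card_gt_0_iff by (intro conjI) (blast, simp)
    ultimately show ?case
      by (simp add: field_simps)
  qed
  ultimately have "(\<lambda>N. f N / g N) \<longlonglongrightarrow> 1"
    by (simp add: Lim_transform_eventually)
  then have "f \<sim>[at_top] g"
    by (rule asymp_equivI')
  then show ?thesis
    using \<open>16 * real k < 100 / \<epsilon>\<close> unfolding f_def g_def by (intro exI[of _ "16 * k"]) simp
qed

end
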